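(* Let $A\in\mathbb{R}^{n\times n}$ be non-singular, regarded as a linear map from $\mathbb{R}^n$ with a given norm (the domain) to $\mathbb{R}^n$ with a given norm (the codomain). Let $\mathcal{C}\subseteq\mathbb{R}^n$ be a polytope in the domain, let $\mathcal{D}:=A(\mathcal{C})$ in the codomain, and let $G\in\mathrm{faces}(\mathcal{D})$. Then for $F:=A^{-1}(G)\cap\mathcal{C}\in\mathrm{faces}(\mathcal{C})$ it holds that $$\frac{\Phi(F,\mathcal{C})}{\|A^{-1}\|}\ \le\ \Phi(G,\mathcal{D})\ \le\ \|A\|\,\Phi(F,\mathcal{C}),$$ where $\|A\|$ and $\|A^{-1}\|$ are the operator norms induced by the given norms on domain and codomain, $\Phi(F,\mathcal{C})$ is computed with the domain norm, and $\Phi(G,\mathcal{D})$ is computed with the codomain norm.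
   Context: A polytope is the convex hull of a finite set of points. $\mathrm{vert}(\mathcal{C})$ is the set of vertices of $\mathcal{C}$ and $\mathrm{faces}(\mathcal{C})$ is the set of nonempty faces (including $\mathcal{C}$ itself). For $H\in\mathrm{faces}(\mathcal{C})$, $H\neq\mathcal{C}$, $\mathcal{C}[H]:=\mathrm{conv}(\mathrm{vert}(\mathcal{C})\setminus H)$. For sets $S,T$ in a normed space, $\mathrm{dist}(S,T)=\min_{x\in S,\,y\in T}\|x-y\|$. The facial distance from $F\in\mathrm{faces}(\mathcal{C})$ is $\Phi(F,\mathcal{C}):=\min_{H\in\mathrm{faces}(F),\ H\subsetneq\mathcal{C}}\mathrm{dist}(H,\mathcal{C}[H])$; the same definitions apply to $\mathcal{D}$. *)

theory Defs
  imports "HOL-Analysis.Analysis"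
begin

text \<open>
  The type class norm on \<^typ>\<open>real ^ 'n\<close> is the Euclidean one. Since domain and codomain carry
  arbitrary norms, norms are explicit functions here.
\<close>

definition is_norm :: "('a::real_vector \<Rightarrow> real) \<Rightarrow> bool" where
  "is_norm N \<longleftrightarrow>
     (\<forall>x. 0 \<le> N x) \<and>
     (\<forall>x. N x = 0 \<longleftrightarrow> x = 0) \<and>
     (\<forall>c x. N (c *\<^sub>R x) = \<bar>c\<bar> * N x) \<and>
     (\<forall>x y. N (x + y) \<le> N x + N y)"

text \<open>
  The same supremum as in \<^const>\<open>onorm\<close>; the term for \<^prop>\<open>x = 0\<close> is \<open>0\<close> by division by zero.
\<close>

definition op_norm ::
    "('a::real_vector \<Rightarrow> real) \<Rightarrow> ('b::real_vector \<Rightarrow> real) \<Rightarrow> ('a \<Rightarrow> 'b) \<Rightarrow> real" where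
  "op_norm N M f = (SUP x. M (f x) / N x)"

definition set_dist :: "('a::real_vector \<Rightarrow> real) \<Rightarrow> 'a set \<Rightarrow> 'a set \<Rightarrow> real" where
  "set_dist N S T = Inf {N (x - y) | x y. x \<in> S \<and> y \<in> T}"

definition vert :: "'a::real_vector set \<Rightarrow> 'a set" where
  "vert C = {v. v extreme_point_of C}"

definition faces :: "'a::real_vector set \<Rightarrow> 'a set set" where
  "faces C = {H. H face_of C \<and> H \<noteq> {}}"

definition away_from :: "'a::real_vector set \<Rightarrow> 'a set \<Rightarrow> 'a set" where
  "away_from C H = convex hull (vert C - H)"

text \<open>
  For a polytope \<open>C\<close> and \<open>F \<in> faces C\<close> there are finitely many \<open>H\<close>, and each \<open>H\<close> and
  \<open>away_from C H\<close> is nonempty and compact, so both infima are minima. The index set is empty only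
  if \<open>C\<close> is a single point; the value is then \<open>\<infinity>\<close>, which is why it is an extended real.
\<close>

definition facial_distance :: "('a::real_vector \<Rightarrow> real) \<Rightarrow> 'a set \<Rightarrow> 'a set \<Rightarrow> ereal" where
  "facial_distance N F C =
     (INF H \<in> {H \<in> faces F. H \<subset> C}. ereal (set_dist N H (away_from C H)))"

end

theory Submission
  imports Defs
begin

text \<open>
  An injective linear map \<open>f\<close> carries the whole facial structure of \<open>C\<close> to that of \<open>f ` C\<close>: faces
  go to faces, vertices to vertices, and convex hulls to convex hulls. The two facial distances are
  therefore infima over corresponding pairs \<open>(H, away_from C H)\<close> and
  \<open>(f ` H, away_from (f ` C) (f ` H))\<close>, and for each pair the distance grows at most by the factor
  \<open>op_norm N M f\<close> (\<open>facial_distance_linear_image_le\<close>). This is the upper estimate; the lower one is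
  the same fact for the inverse map, which takes \<open>f ` C\<close> back to \<open>C\<close>.

  Two points keep the suprema and infima, taken in the reals, meaningful. The supremum defining
  \<open>op_norm\<close> is over a bounded set, because a norm on a Euclidean space is continuous and the unit
  sphere is compact (\<open>bdd_above_op_norm\<close>). The infimum defining \<open>set_dist\<close> is over a nonempty set,
  because by the Krein--Milman theorem a proper face misses some vertex (\<open>away_from_nonempty\<close>).
\<close>

section \<open>Operator norms\<close>

lemma is_norm_continuous_on:
  fixes N :: "'a::euclidean_space \<Rightarrow> real"
  assumes "is_norm N"
  shows "continuous_on S N"
proof -
  have "convex_on UNIV N"
  proof (rule convex_onI)
    fix t :: real and x y :: 'a
    assume t: "0 < t" "t < 1"
    have "N ((1 - t) *\<^sub>R x + t *\<^sub>R y) \<le> N ((1 - t) *\<^sub>R x) + N (t *\<^sub>R y)"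
      using assms unfolding is_norm_def by blast
    also have "\<dots> = \<bar>1 - t\<bar> * N x + \<bar>t\<bar> * N y"
      using assms unfolding is_norm_def by metis
    finally show "N ((1 - t) *\<^sub>R x + t *\<^sub>R y) \<le> (1 - t) * N x + t * N y"
      using t by simp
  qed simp
  then have "continuous_on UNIV N"
    using convex_on_continuous open_UNIV by blast
  then show ?thesis
    using continuous_on_subset by blast
qed

text \<open>
  The quotient is invariant under scaling of \<open>x\<close>, so its nonzero values are already taken on the
  Euclidean unit sphere, where it is continuous and hence bounded.
\<close>

lemma bdd_above_op_norm:
  fixes N :: "'a::euclidean_space \<Rightarrow> real" and M :: "'b::euclidean_space \<Rightarrow> real"
  assumes N: "is_norm N" and M: "is_norm M" and f: "linear f"
  shows "bdd_above (range (\<lambda>x. M (f x) / N x))"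
proof -
  let ?q = "\<lambda>x. M (f x) / N x"
  have "continuous_on (sphere 0 1) (\<lambda>x. M (f x))"
    using continuous_on_compose2[OF is_norm_continuous_on[OF M, of UNIV]]
      linear_continuous_on_compose[OF continuous_on_id f] by blast
  moreover have "\<forall>x \<in> sphere 0 1. N x \<noteq> 0"
    using N by (auto simp: is_norm_def)
  ultimately have "compact (?q ` sphere 0 1)"
    using is_norm_continuous_on[OF N]
    by (intro compact_continuous_image continuous_on_divide) auto
  then have "bdd_above (insert 0 (?q ` sphere 0 1))"
    by (simp add: bounded_imp_bdd_above compact_imp_bounded)
  moreover have "range ?q \<subseteq> insert 0 (?q ` sphere 0 1)"
  proof (rule image_subsetI)
    fix x
    show "?q x \<in> insert 0 (?q ` sphere 0 1)"
    proof (cases "x = 0")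
      case True
      then have "?q x = 0"
        using N by (simp add: is_norm_def)
      then show ?thesis
        by blast
    next
      case x: False
      let ?c = "inverse (norm x)"
      have "N (?c *\<^sub>R x) = ?c * N x" "M (f (?c *\<^sub>R x)) = ?c * M (f x)"
        using N M f by (simp_all add: is_norm_def linear_scale)
      then have "?q x = ?q (?c *\<^sub>R x)"
        using x by simp
      moreover have "?c *\<^sub>R x \<in> sphere 0 1"
        using x by simp
      ultimately show ?thesis
        by blast
    qed
  qed
  ultimately show ?thesis
    by (rule bdd_above_mono)
qed

lemma le_op_norm:
  fixes N :: "'a::euclidean_space \<Rightarrow> real" and M :: "'b::euclidean_space \<Rightarrow> real"
  assumes "is_norm N" and "is_norm M" and "linear f"
  shows "M (f x) \<le> op_norm N M f * N x"
proof (cases "x = 0")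
  case True
  then have "M (f x) = 0" "N x = 0"
    using assms by (auto simp: is_norm_def linear_0)
  then show ?thesis
    by simp
next
  case False
  then have "N x > 0"
    using assms(1) unfolding is_norm_def by (metis less_eq_real_def)
  moreover have "M (f x) / N x \<le> op_norm N M f"
    unfolding op_norm_def using bdd_above_op_norm[OF assms] by (rule cSUP_upper[OF UNIV_I])
  ultimately show ?thesis
    by (simp add: pos_divide_le_eq)
qed

lemma op_norm_pos:
  fixes N :: "'a::euclidean_space \<Rightarrow> real" and M :: "'b::euclidean_space \<Rightarrow> real"
  assumes "is_norm N" and "is_norm M" and "linear f" and "inj f"
  shows "op_norm N M f > 0"
proof -
  obtain x :: 'a where x: "x \<noteq> 0"
    using SOME_Basis nonzero_Basis by blast
  then have "f x \<noteq> 0"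
    using assms(3,4) linear_injective_0 by blast
  then have "0 < M (f x)" "0 < N x"
    using assms(1,2) x unfolding is_norm_def by (metis less_eq_real_def)+
  then show ?thesis
    using le_op_norm[OF assms(1-3), of x] by (smt (verit) mult_nonpos_nonneg)
qed

section \<open>Faces under injective linear maps\<close>

lemma vert_linear_image:
  assumes "linear f" and "inj f"
  shows "vert (f ` C) = f ` vert C"
proof -
  have "f v extreme_point_of f ` C \<longleftrightarrow> v extreme_point_of C" for v
    using face_of_linear_image[OF assms, of "{v}" C] by (simp add: face_of_singleton)
  moreover have "v \<in> f ` C" if "v extreme_point_of f ` C" for v
    using that by (simp add: extreme_point_of_def)
  ultimately show ?thesis
    unfolding vert_def by blast
qed

lemma away_from_linear_image:
  assumes "linear f" and "inj f"
  shows "away_from (f ` C) (f ` H) = f ` away_from C H"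
  by (simp add: away_from_def vert_linear_image assms image_set_diff[symmetric]
      convex_hull_linear_image)

lemma away_from_nonempty:
  fixes C :: "'a::euclidean_space set"
  assumes "compact C" and "convex C" and "H face_of C" and "H \<noteq> C"
  shows "away_from C H \<noteq> {}"
proof
  assume "away_from C H = {}"
  then have "vert C \<subseteq> H"
    by (simp add: away_from_def)
  then have "convex hull (vert C) \<subseteq> H"
    using assms(3) by (simp add: face_of_imp_convex hull_minimal)
  moreover have "C = convex hull (vert C)"
    unfolding vert_def using Krein_Milman_Minkowski assms(1,2) by blast
  ultimately show False
    using assms(3,4) face_of_imp_subset by blast
qed

lemma faces_linear_image:
  assumes "linear f" and "inj f"
  shows "f ` H \<in> faces (f ` C) \<longleftrightarrow> H \<in> faces C"
  by (simp add: faces_def face_of_linear_image assms)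

section \<open>Distances under linear maps\<close>

lemma set_dist_linear_image_le:
  fixes N :: "'a::euclidean_space \<Rightarrow> real" and M :: "'b::euclidean_space \<Rightarrow> real"
  assumes N: "is_norm N" and M: "is_norm M" and f: "linear f" "inj f"
    and "S \<noteq> {}" and "T \<noteq> {}"
  shows "set_dist M (f ` S) (f ` T) \<le> op_norm N M f * set_dist N S T"
proof -
  let ?K = "op_norm N M f"
  have K: "?K > 0"
    using assms op_norm_pos by blast
  have "set_dist M (f ` S) (f ` T) / ?K \<le> N (x - y)" if "x \<in> S" "y \<in> T" for x y
  proof -
    have "set_dist M (f ` S) (f ` T) \<le> M (f x - f y)"
      unfolding set_dist_def
    proof (rule cInf_lower)
      show "bdd_below {M (x - y) |x y. x \<in> f ` S \<and> y \<in> f ` T}"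
        using M by (auto simp: is_norm_def intro: bdd_belowI[of _ 0])
    qed (use that in blast)
    also have "\<dots> = M (f (x - y))"
      using f by (simp add: linear_diff)
    also have "\<dots> \<le> ?K * N (x - y)"
      using N M f(1) by (rule le_op_norm)
    finally show ?thesis
      using K by (simp add: pos_divide_le_eq mult.commute)
  qed
  then have "set_dist M (f ` S) (f ` T) / ?K \<le> set_dist N S T"
    unfolding set_dist_def[of N] using assms(5,6) by (intro cInf_greatest) blast+
  then show ?thesis
    using K by (simp add: pos_divide_le_eq mult.commute)
qed

text \<open>
  Each face \<open>H\<close> admitted on the right gives the face \<open>f ` H\<close> admitted on the left, so the two
  infima compare termwise. Dividing on the left keeps the factor out of the infimum, so that the
  case of a one-point \<open>C\<close>, where both facial distances are \<open>\<infinity>\<close>, is not special.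
\<close>

lemma facial_distance_linear_image_le:
  fixes N :: "'a::euclidean_space \<Rightarrow> real" and M :: "'b::euclidean_space \<Rightarrow> real"
  assumes N: "is_norm N" and M: "is_norm M" and f: "linear f" "inj f"
    and C: "compact C" "convex C" and F: "F \<in> faces C"
  shows "facial_distance M (f ` F) (f ` C) / ereal (op_norm N M f) \<le> facial_distance N F C"
  unfolding facial_distance_def[of N]
proof (rule INF_greatest)
  fix H
  assume "H \<in> {H \<in> faces F. H \<subset> C}"
  then have H: "H \<in> faces F" "H \<subset> C"
    by simp_all
  let ?K = "op_norm N M f"
  have K: "?K > 0"
    using N M f by (rule op_norm_pos)
  have "H face_of C"
    using H(1) F face_of_trans unfolding faces_def by blast
  then have "away_from C H \<noteq> {}"
    using away_from_nonempty C H(2) by blast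
  moreover have "H \<noteq> {}"
    using H(1) by (simp add: faces_def)
  ultimately have "set_dist M (f ` H) (f ` away_from C H) \<le> ?K * set_dist N H (away_from C H)"
    by (intro set_dist_linear_image_le N M f)
  moreover have "facial_distance M (f ` F) (f ` C)
      \<le> ereal (set_dist M (f ` H) (away_from (f ` C) (f ` H)))"
    unfolding facial_distance_def
  proof (rule INF_lower)
    have "f ` H \<subset> f ` C"
      using H(2) f(2) by (simp add: inj_image_subset_iff inj_image_eq_iff psubset_eq)
    then show "f ` H \<in> {H \<in> faces (f ` F). H \<subset> f ` C}"
      using H(1) f by (simp add: faces_linear_image)
  qed
  ultimately have "facial_distance M (f ` F) (f ` C)
      \<le> ereal ?K * ereal (set_dist N H (away_from C H))"
    using f by (simp add: away_from_linear_image order_trans)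
  then show "facial_distance M (f ` F) (f ` C) / ereal ?K
      \<le> ereal (set_dist N H (away_from C H))"
    using K by (simp add: ereal_divide_le_pos)
qed

section \<open>Facial distance of a linear image of a polytope\<close>

theorem corollary5p2:
  fixes A :: "real ^ 'n ^ 'n"
    and N M :: "real ^ 'n \<Rightarrow> real"
    and C G :: "(real ^ 'n) set"
  assumes "is_norm N" and "is_norm M"
    and "invertible A"
    and "polytope C"
    and "G \<in> faces ((*v) A ` C)"
  shows "let D = (*v) A ` C; F = (*v) A -` G \<inter> C in
           F \<in> faces C \<and>
           facial_distance N F C / ereal (op_norm M N ((*v) (matrix_inv A)))
             \<le> facial_distance M G D \<and>
           facial_distance M G D
             \<le> ereal (op_norm N M ((*v) A)) * facial_distance N F C"
proof -
  let ?f = "(*v) A" and ?g = "(*v) (matrix_inv A)"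
  define D F where "D = ?f ` C" and "F = ?f -` G \<inter> C"
  have inv: "matrix_inv A ** A = mat 1" "A ** matrix_inv A = mat 1"
    using someI_ex[OF assms(3)[unfolded invertible_def]] by (simp_all add: matrix_inv_def)
  then have gf: "?g (?f x) = x" and fg: "?f (?g x) = x" for x
    by (simp_all add: matrix_vector_mul_assoc)
  have f: "linear ?f" "inj ?f" and g: "linear ?g" "inj ?g"
    by (auto intro: inj_on_inverseI gf fg)
  have C: "compact C" "convex C" "compact D" "convex D"
    using assms(4) f(1) by (simp_all add: D_def polytope_imp_compact polytope_imp_convex
        polytope_linear_image)
  have "G \<subseteq> D"
    using assms(5) face_of_imp_subset unfolding faces_def D_def by blast
  then have fF: "?f ` F = G"
    by (auto simp: F_def D_def)
  have G: "G \<in> faces D"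
    using assms(5) by (simp add: D_def)
  then have F: "F \<in> faces C"
    using f faces_linear_image by (metis D_def fF)
  have "?g ` G = F" "?g ` D = C"
    unfolding D_def fF[symmetric] by (simp_all add: image_image gf)
  then have "facial_distance N F C / ereal (op_norm M N ?g) \<le> facial_distance M G D"
    using facial_distance_linear_image_le[OF assms(2,1) g C(3,4) G] by simp
  moreover have "facial_distance M G D / ereal (op_norm N M ?f) \<le> facial_distance N F C"
    using facial_distance_linear_image_le[OF assms(1,2) f C(1,2) F] by (simp add: fF D_def)
  then have "facial_distance M G D \<le> ereal (op_norm N M ?f) * facial_distance N F C"
    using op_norm_pos[OF assms(1,2) f] by (simp add: ereal_divide_le_pos)
  ultimately show ?thesis
    using F by (simp add: Let_def D_def F_def)
qed

end
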